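(* Let $(X,r)$ be a solution, and let $k$ be a reflection for $(X,r)$. Take $p,q\in\mathbb{N}$, $\overline{a}\in X^p$, $\overline{b}\in X^q$. Then $$J^{p+q;k}(\overline{a}\,\overline{b})=J^{p;k}\bigl(\rho_{\Delta^{q;k}(\overline{b})}(\overline{a})\bigr)\ J^{q;k}(\overline{b}),$$ $$\Delta^{p+q;k}(\overline{a}\,\overline{b})=\lambda_{\overline{a}}\bigl(\Delta^{q;k}(\overline{b})\bigr)\ \Delta^{p;k}\bigl(\rho_{\Delta^{q;k}(\overline{b})}(\overline{a})\bigr),$$ where juxtaposition denotes concatenation of tuples.
   Context: Products of maps denote composition, the rightmost map being applied first. For a map $\phi\colon X^m\to X^m$, $\phi_i$ denotes the map on $X^n$ that applies $\phi$ to the $m$ consecutive coordinates starting at position $i$ and is the identity on the others. A solution $(X,r)$ is a set $X$ with a map $r\colon X\times X\to X\times X$ (not assumed bijective or non-degenerate) satisfying the Yang–Baxter equation $r_1r_2r_1=r_2r_1r_2$ on $X^3$; write $r(a,b)=(\lambda_a(b),\rho_b(a))$. A reflection for $(X,r)$ is a map $k\colon X\to X$ with $r k_2 r k_2=k_2 r k_2 r$ on $X^2$. Extension of $\lambda,\rho$ to tuples: for $\overline{a}\in X^p$, $\overline{b}\in X^q$, the elements $\lambda_{\overline{a}}(\overline{b})\in X^q$ and $\rho_{\overline{b}}(\overline{a})\in X^p$ are defined by $$\bigl(\lambda_{\overline{a}}(\overline{b}),\rho_{\overline{b}}(\overline{a})\bigr)=(r_q r_{q+1}\cdots r_{q+p-1})\cdots(r_2r_3\cdots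 r_{p+1})(r_1r_2\cdots r_p)(\overline{a}\,\overline{b}),$$ i.e. each entry of $\overline{b}$ is moved to the left past all the entries of $\overline{a}$ using $r$. In particular, for $p=1$, $\rho_{(b_1,\ldots,b_m)}=\rho_{b_m}\cdots\rho_{b_2}\rho_{b_1}$. The $k$-Garside maps $\Delta^{n;k}\colon X^n\to X^n$ are $$\Delta^{n;k}=k_n\,(r_{n-1}\cdots r_2r_1)\,k_n\cdots k_n\,(r_{n-1}r_{n-2})\,k_n\,r_{n-1}\,k_n,$$ that is, $\Delta^{1;k}=k$ and $\Delta^{n;k}=k_n\, r_{n-1}\cdots r_2 r_1\,(\mathrm{Id}_X\times\Delta^{n-1;k})$ for $n\ge 2$. The $k$-guitar maps $J^{n;k}\colon X^n\to X^n$ send $(a_1,\ldots,a_n)$ to $$\bigl(\rho_{\Delta^{n-1;k}(a_2,\ldots,a_n)}(a_1),\ \rho_{\Delta^{n-2;k}(a_3,\ldots,a_n)}(a_2),\ \ldots,\ \rho_{\Delta^{2;k}(a_{n-1},a_n)}(a_{n-2}),\ \rho_{k(a_n)}(a_{n-1}),\ a_n\bigr).$$ *)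

theory Defs
  imports Main
begin

text \<open>
  The set \<open>X\<close> is a type \<open>'a\<close> and \<open>X\<^sup>n\<close> is represented by the lists of length \<open>n\<close>.
  Positions are counted from 1, so \<open>apply2 r i\<close> and \<open>apply1 k i\<close> are
  \<open>r\<^sub>i\<close> and \<open>k\<^sub>i\<close>; they are meaningful for \<open>1 \<le> i\<close> and, respectively,
  \<open>i + 1 \<le> length xs\<close> and \<open>i \<le> length xs\<close>.
\<close>

definition apply1 :: "('a \<Rightarrow> 'a) \<Rightarrow> nat \<Rightarrow> 'a list \<Rightarrow> 'a list" where
  "apply1 k i xs = xs[i - 1 := k (xs ! (i - 1))]"

definition apply2 :: "('a \<times> 'a \<Rightarrow> 'a \<times> 'a) \<Rightarrow> nat \<Rightarrow> 'a list \<Rightarrow> 'a list" where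
  "apply2 r i xs = (let (x, y) = r (xs ! (i - 1), xs ! i) in xs[i - 1 := x, i := y])"

definition solution :: "('a \<times> 'a \<Rightarrow> 'a \<times> 'a) \<Rightarrow> bool" where
  "solution r \<longleftrightarrow> (\<forall>xs. length xs = 3 \<longrightarrow>
     apply2 r 1 (apply2 r 2 (apply2 r 1 xs)) = apply2 r 2 (apply2 r 1 (apply2 r 2 xs)))"

text \<open>On \<open>X\<^sup>2\<close> the map \<open>r\<close> itself is \<open>apply2 r 1\<close>.\<close>

definition reflection :: "('a \<times> 'a \<Rightarrow> 'a \<times> 'a) \<Rightarrow> ('a \<Rightarrow> 'a) \<Rightarrow> bool" where
  "reflection r k \<longleftrightarrow> (\<forall>xs. length xs = 2 \<longrightarrow>
     apply2 r 1 (apply1 k 2 (apply2 r 1 (apply1 k 2 xs))) =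
     apply1 k 2 (apply2 r 1 (apply1 k 2 (apply2 r 1 xs))))"

text \<open>
  \<open>foldr f [i\<^sub>1, \<dots>, i\<^sub>m]\<close> is the product \<open>f i\<^sub>1 \<circ> \<dots> \<circ> f i\<^sub>m\<close>, whereas
  \<open>fold f [i\<^sub>1, \<dots>, i\<^sub>m]\<close> is \<open>f i\<^sub>m \<circ> \<dots> \<circ> f i\<^sub>1\<close>.  Hence \<open>cross r p q\<close> is
  \<open>(r\<^sub>q \<dots> r\<^bsub>q+p-1\<^esub>) \<dots> (r\<^sub>2 \<dots> r\<^bsub>p+1\<^esub>) (r\<^sub>1 \<dots> r\<^sub>p)\<close>.
\<close>

definition cross :: "('a \<times> 'a \<Rightarrow> 'a \<times> 'a) \<Rightarrow> nat \<Rightarrow> nat \<Rightarrow> 'a list \<Rightarrow> 'a list" where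
  "cross r p q = fold (\<lambda>j. foldr (apply2 r) [j..<j + p]) [1..<q + 1]"

text \<open>\<open>lam r a b\<close> is \<open>\<lambda>\<^sub>a(b)\<close> and \<open>rho r b a\<close> is \<open>\<rho>\<^sub>b(a)\<close>, for tuples \<open>a\<close> and \<open>b\<close>.\<close>

definition lam :: "('a \<times> 'a \<Rightarrow> 'a \<times> 'a) \<Rightarrow> 'a list \<Rightarrow> 'a list \<Rightarrow> 'a list" where
  "lam r a b = take (length b) (cross r (length a) (length b) (a @ b))"

definition rho :: "('a \<times> 'a \<Rightarrow> 'a \<times> 'a) \<Rightarrow> 'a list \<Rightarrow> 'a list \<Rightarrow> 'a list" where
  "rho r b a = drop (length b) (cross r (length a) (length b) (a @ b))"

text \<open>
  \<open>garside r k n\<close> is \<open>\<Delta>\<^bsup>n;k\<^esup>\<close>, meaningful on lists of length \<open>n\<close>, with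
  \<open>\<Delta>\<^bsup>0;k\<^esup>\<close> the identity of the one-point set \<open>X\<^sup>0\<close>.  For \<open>n = 1\<close> the product
  \<open>r\<^bsub>n-1\<^esub> \<dots> r\<^sub>1\<close> is empty and the recursion gives \<open>k\<close>.
\<close>

primrec garside ::
  "('a \<times> 'a \<Rightarrow> 'a \<times> 'a) \<Rightarrow> ('a \<Rightarrow> 'a) \<Rightarrow> nat \<Rightarrow> 'a list \<Rightarrow> 'a list" where
  "garside r k 0 xs = xs"
| "garside r k (Suc n) xs =
     apply1 k (n + 1) (fold (apply2 r) [1..<n + 1] (hd xs # garside r k n (tl xs)))"

text \<open>
  The \<open>j\<close>-th entry of the guitar map is \<open>\<rho>\<close> of a 1-tuple, whose only entry is
  extracted by \<open>hd\<close>; for \<open>j = n\<close> the acting tuple is empty and the entry is \<open>a\<^sub>n\<close>.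
\<close>

definition guitar ::
  "('a \<times> 'a \<Rightarrow> 'a \<times> 'a) \<Rightarrow> ('a \<Rightarrow> 'a) \<Rightarrow> nat \<Rightarrow> 'a list \<Rightarrow> 'a list" where
  "guitar r k n a =
     map (\<lambda>j. hd (rho r (garside r k (n - j) (drop j a)) [a ! (j - 1)])) [1..<n + 1]"

end

theory Submission
  imports Defs
begin

text \<open>
  In the braid-like picture of \<open>cross\<close>, every entry of \<open>a\<close> crosses every entry of \<open>b\<close> exactly
  once, and crossings at disjoint positions commute.  So the grid of crossings may be evaluated
  column by column (each entry of \<open>b\<close> moves left past all of \<open>a\<close>, as \<open>cross\<close> does) or row by row
  (each entry of \<open>a\<close>, the last one first, moves right past all of \<open>b\<close>).  The row description is
  the useful one here: \<open>\<Delta>\<close> is itself built by letting the first entry move right past \<open>\<Delta>\<close> of the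
  remaining ones, hitting \<open>k\<close> at the right end.

  Both identities then follow together by induction on \<open>a\<close>.  For \<open>x # a\<close>, the induction
  hypothesis writes \<open>\<Delta>(a b)\<close> as the concatenation of \<open>\<lambda>\<^sub>a(\<Delta> b)\<close> and \<open>\<Delta>(\<rho>\<^bsub>\<Delta> b\<^esub>(a))\<close>.  The entry
  \<open>x\<close> moves right past the first block, which produces \<open>\<lambda>\<^bsub>x a\<^esub>(\<Delta> b)\<close> and turns \<open>x\<close> into the first
  entry of \<open>\<rho>\<^bsub>\<Delta> b\<^esub>(x a)\<close>.  It then moves past the second block and meets \<open>k\<close>, which is how \<open>\<Delta>\<close>
  and \<open>J\<close> of \<open>\<rho>\<^bsub>\<Delta> b\<^esub>(x a)\<close> are computed.  The lemmas \<open>cross_append\<close>, \<open>garside_Cons\<close> and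
  \<open>guitar_Cons\<close> translate the positional definitions into these recursions.
\<close>

section \<open>Moving entries past tuples\<close>

primrec lam_elem :: "('a \<times> 'a \<Rightarrow> 'a \<times> 'a) \<Rightarrow> 'a \<Rightarrow> 'a list \<Rightarrow> 'a list" where
  "lam_elem r x [] = []"
| "lam_elem r x (c # cs) = fst (r (x, c)) # lam_elem r (snd (r (x, c))) cs"

primrec rho_elem :: "('a \<times> 'a \<Rightarrow> 'a \<times> 'a) \<Rightarrow> 'a \<Rightarrow> 'a list \<Rightarrow> 'a" where
  "rho_elem r x [] = x"
| "rho_elem r x (c # cs) = rho_elem r (snd (r (x, c))) cs"

text \<open>
  The next two functions evaluate the grid of crossings row by row; they turn out to be
  \<open>lam\<close> and \<open>rho\<close>.
\<close>

primrec lam_rows :: "('a \<times> 'a \<Rightarrow> 'a \<times> 'a) \<Rightarrow> 'a list \<Rightarrow> 'a list \<Rightarrow> 'a list" where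
  "lam_rows r [] c = c"
| "lam_rows r (x # a) c = lam_elem r x (lam_rows r a c)"

primrec rho_rows :: "('a \<times> 'a \<Rightarrow> 'a \<times> 'a) \<Rightarrow> 'a list \<Rightarrow> 'a list \<Rightarrow> 'a list" where
  "rho_rows r [] c = []"
| "rho_rows r (x # a) c = rho_elem r x (lam_rows r a c) # rho_rows r a c"

lemma length_lam_elem [simp]: "length (lam_elem r x c) = length c"
  by (induction c arbitrary: x) auto

lemma length_lam_rows [simp]: "length (lam_rows r a c) = length c"
  by (induction a) auto

lemma length_rho_rows [simp]: "length (rho_rows r a c) = length a"
  by (induction a) auto

lemma lam_elem_append:
  "lam_elem r x (c @ d) = lam_elem r x c @ lam_elem r (rho_elem r x c) d"
  by (induction c arbitrary: x) auto

lemma rho_elem_append: "rho_elem r x (c @ d) = rho_elem r (rho_elem r x c) d"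
  by (induction c arbitrary: x) auto

lemma rows_Nil [simp]: "lam_rows r a [] = []" "rho_rows r a [] = a"
  by (induction a) auto

text \<open>
  Cutting the grid of crossings along a vertical line; for \<open>b\<close> of length 1 this compares its
  evaluation by rows with the one by columns.
\<close>

lemma rows_append:
  "lam_rows r a (b @ c) = lam_rows r a b @ lam_rows r (rho_rows r a b) c"
  "rho_rows r a (b @ c) = rho_rows r (rho_rows r a b) c"
  by (induction a) (auto simp: lam_elem_append rho_elem_append)

section \<open>Recursive descriptions of the positional definitions\<close>

lemma apply2_Suc_Cons: "1 \<le> i \<Longrightarrow> apply2 r (Suc i) (x # xs) = x # apply2 r i xs"
  by (cases i) (auto simp: apply2_def split: prod.split)

lemma apply2_1_Cons:
  "apply2 r (Suc 0) (x # y # xs) = fst (r (x, y)) # snd (r (x, y)) # xs"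
  by (auto simp: apply2_def split: prod.split)

lemma fold_Suc_Cons:
  assumes "\<And>i xs. i \<in> set is \<Longrightarrow> f (Suc i) (x # xs) = x # f i xs"
  shows "fold f (map Suc is) (x # xs) = x # fold f is xs"
  using assms by (induction "is" arbitrary: xs) auto

lemma foldr_Suc_Cons:
  assumes "\<And>i xs. i \<in> set is \<Longrightarrow> f (Suc i) (x # xs) = x # f i xs"
  shows "foldr f (map Suc is) (x # xs) = x # foldr f is xs"
  using assms by (induction "is") auto

lemma fold_apply2_Suc_Cons:
  "0 < i \<Longrightarrow>
    fold (apply2 r) (map Suc [i..<j]) (x # xs) = x # fold (apply2 r) [i..<j] xs"
  by (intro fold_Suc_Cons apply2_Suc_Cons) auto

lemma foldr_apply2_Suc_Cons:
  "0 < i \<Longrightarrow>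
    foldr (apply2 r) (map Suc [i..<j]) (x # xs) = x # foldr (apply2 r) [i..<j] xs"
  by (intro foldr_Suc_Cons apply2_Suc_Cons) auto

lemma upt_1_Suc: "[Suc 0..<Suc (Suc n)] = Suc 0 # map Suc [Suc 0..<Suc n]"
  by (simp add: upt_conv_Cons map_Suc_upt del: upt_Suc)

lemma fold_apply2_Cons:
  "fold (apply2 r) [1..<length c + 1] (x # c) = lam_elem r x c @ [rho_elem r x c]"
proof (induction c arbitrary: x)
  case Nil
  show ?case by simp
next
  case (Cons y c)
  have "fold (apply2 r) [1..<length (y # c) + 1] (x # y # c) =
      fst (r (x, y)) # fold (apply2 r) [1..<length c + 1] (snd (r (x, y)) # c)"
    by (simp add: upt_1_Suc apply2_1_Cons fold_apply2_Suc_Cons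
        del: upt_Suc map_Suc_upt)
  with Cons.IH show ?case by simp
qed

lemma foldr_apply2_column:
  "foldr (apply2 r) [1..<1 + length a] (a @ c # b) = lam_rows r a [c] @ rho_rows r a [c] @ b"
proof (induction a)
  case Nil
  show ?case by simp
next
  case (Cons x a)
  obtain c' where c': "lam_rows r a [c] = [c']"
    using length_lam_rows[of r a "[c]"] by (auto simp: length_Suc_conv simp del: length_lam_rows)
  have "foldr (apply2 r) [1..<1 + length (x # a)] ((x # a) @ c # b) =
      apply2 r 1 (x # foldr (apply2 r) [1..<1 + length a] (a @ c # b))"
    by (simp add: upt_1_Suc foldr_apply2_Suc_Cons del: upt_Suc map_Suc_upt foldr_map)
  with Cons.IH c' show ?case by (simp add: apply2_1_Cons)
qed

text \<open>
  Since \<open>cross\<close> works by columns, the induction is on \<open>b\<close>: its first entry moves left past \<open>a\<close>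
  and is never touched again, and the other columns are those of a smaller grid, shifted by one.
\<close>

lemma cross_append:
  "cross r (length a) (length b) (a @ b) = lam_rows r a b @ rho_rows r a b"
proof (induction b arbitrary: a)
  case Nil
  show ?case by (simp add: cross_def)
next
  case (Cons c b)
  let ?f = "\<lambda>j. foldr (apply2 r) [j..<j + length a]"
  obtain c' where c': "lam_rows r a [c] = [c']"
    using length_lam_rows[of r a "[c]"] by (auto simp: length_Suc_conv simp del: length_lam_rows)
  have shift: "?f (Suc j) (y # ys) = y # ?f j ys" if "j \<in> set [1..<length b + 1]" for j y ys
  proof -
    have "[Suc j..<Suc j + length a] = map Suc [j..<j + length a]"
      by (simp only: map_Suc_upt add_Suc)
    moreover have "foldr (apply2 r) (map Suc [j..<j + length a]) (y # ys) = y # ?f j ys"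
      using that by (intro foldr_apply2_Suc_Cons) auto
    ultimately show ?thesis by (simp only:)
  qed
  have "cross r (length a) (length (c # b)) (a @ c # b) =
      fold ?f (map Suc [1..<length b + 1]) (?f 1 (a @ c # b))"
    unfolding cross_def by (simp add: upt_1_Suc del: upt_Suc map_Suc_upt)
  also have "?f 1 (a @ c # b) = c' # rho_rows r a [c] @ b"
    using foldr_apply2_column[of r a c b] c' by simp
  also have "fold ?f (map Suc [1..<length b + 1]) (c' # rho_rows r a [c] @ b) =
      c' # fold ?f [1..<length b + 1] (rho_rows r a [c] @ b)"
    by (intro fold_Suc_Cons shift)
  also have "fold ?f [1..<length b + 1] (rho_rows r a [c] @ b) =
      lam_rows r (rho_rows r a [c]) b @ rho_rows r (rho_rows r a [c]) b"
    using Cons.IH[of "rho_rows r a [c]"] by (simp add: cross_def)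
  also have "c' # \<dots> = lam_rows r a (c # b) @ rho_rows r a (c # b)"
    using rows_append[of r a "[c]" b] c' by simp
  finally show ?case .
qed

lemma lam_eq_lam_rows: "lam r a b = lam_rows r a b"
  by (simp add: lam_def cross_append)

lemma rho_eq_rho_rows: "rho r b a = rho_rows r a b"
  by (simp add: rho_def cross_append)

lemma length_garside [simp]: "length xs = n \<Longrightarrow> length (garside r k n xs) = n"
proof (induction n arbitrary: xs)
  case (Suc n)
  have len: "length (fold (apply2 r) is ys) = length ys" for "is" and ys :: "'a list"
    by (induction "is" arbitrary: ys) (auto simp: apply2_def split: prod.split)
  from Suc show ?case by (simp add: apply1_def len del: upt_Suc)
qed simp

lemma garside_Cons:
  assumes "length a = n"
  shows "garside r k (Suc n) (x # a) =
    lam_elem r x (garside r k n a) @ [k (rho_elem r x (garside r k n a))]"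
proof -
  have len: "length (garside r k n a) = n"
    using assms by simp
  have "fold (apply2 r) [1..<n + 1] (x # garside r k n a) =
      lam_elem r x (garside r k n a) @ [rho_elem r x (garside r k n a)]"
    using fold_apply2_Cons[of r "garside r k n a" x] unfolding len .
  with len show ?thesis by (simp add: apply1_def nth_append list_update_append del: upt_Suc)
qed

lemma guitar_Cons:
  "guitar r k (Suc n) (x # a) = rho_elem r x (garside r k n a) # guitar r k n a"
proof -
  have "map (\<lambda>j. hd (rho r (garside r k (Suc n - j) (drop j (x # a))) [(x # a) ! (j - 1)]))
      (map Suc [1..<n + 1]) = guitar r k n a"
    by (auto simp: guitar_def nth_Cons' simp del: upt_Suc map_Suc_upt)
  moreover have "hd (rho r (garside r k n a) [x]) = rho_elem r x (garside r k n a)"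
    by (simp add: rho_eq_rho_rows)
  ultimately show ?thesis
    by (simp add: guitar_def[of r k "Suc n"] upt_1_Suc del: upt_Suc map_Suc_upt)
qed

section \<open>Splitting the Garside and guitar maps\<close>

lemma garside_append:
  "garside r k (length a + length b) (a @ b) =
    lam_rows r a (garside r k (length b) b) @
    garside r k (length a) (rho_rows r a (garside r k (length b) b))"
  by (induction a) (auto simp: garside_Cons lam_elem_append rho_elem_append simp del: garside.simps(2))

lemma guitar_append:
  "guitar r k (length a + length b) (a @ b) =
    guitar r k (length a) (rho_rows r a (garside r k (length b) b)) @ guitar r k (length b) b"
proof (induction a)
  case Nil
  show ?case by (simp add: guitar_def)
next
  case (Cons x a)
  then show ?case by (simp add: guitar_Cons garside_append rho_elem_append)
qed

theorem proposition2p2: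
  fixes r :: "'a \<times> 'a \<Rightarrow> 'a \<times> 'a" and k :: "'a \<Rightarrow> 'a"
    and p q :: nat and a b :: "'a list"
  assumes "solution r" and "reflection r k"
    and "length a = p" and "length b = q"
  shows "guitar r k (p + q) (a @ b) =
           guitar r k p (rho r (garside r k q b) a) @ guitar r k q b
       \<and> garside r k (p + q) (a @ b) =
           lam r a (garside r k q b) @ garside r k p (rho r (garside r k q b) a)"
  using assms(3,4) guitar_append[of r k a b] garside_append[of r k a b]
  by (simp add: lam_eq_lam_rows rho_eq_rho_rows)

end
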